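(* Let $\mathbb{F}$ be a field of prime characteristic $p$ and let $I$ be an $\mathbb{F}$-vector space of dimension $2p$ with basis $\{v_1,\ldots,v_{2p}\}$. Define endomorphisms $x,y$ of $I$ by $$x:\ v_i\mapsto v_{i+1}\ (1\leq i\leq p-1),\quad v_p\mapsto v_1,\quad v_{p+i}\mapsto v_{p+i+1}\ (1\leq i\leq p-1),\quad v_{2p}\mapsto v_{p+1};$$ $$y:\ v_{p+1}\mapsto v_1,\quad v_i\mapsto 0\ \text{ if } i\neq p+1.$$ Let $K$ be the Lie subalgebra of $\mathfrak{gl}(I)$ generated by $x$ and $y$, and let $L=K\ltimes I$ be the semidirect sum of $K$ and the abelian Lie algebra $I$. Then the following hold. (1) $K$ is a nilpotent Lie algebra of dimension $p+1$ and nilpotency class $p$. (2) $L$ is not nilpotent and has derived length $3$. (3) If $|\mathbb{F}|\geq p^2$, then $L$ admits a non-singular derivation of finite order.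
   Context: $\mathfrak{gl}(I)$ is the Lie algebra of endomorphisms of $I$ with bracket $[a,b]=ab-ba$. The semidirect sum $K\ltimes I$ is the vector space $K\oplus I$ with bracket $[(k_1,v_1),(k_2,v_2)]=([k_1,k_2],\,k_1(v_2)-k_2(v_1))$. The derived length of $L$ is the smallest $n$ with $L^{(n)}=0$, where $L^{(0)}=L$ and $L^{(i)}=[L^{(i-1)},L^{(i-1)}]$. A derivation $\delta$ is non-singular if it is an invertible linear map; it has finite order if $\delta^n=\mathrm{id}$ for some $n\geq 1$.
   Formalization: In (3), finite order is claimed only if F has a finite subfield with at least p² elements (automatic for finite F with |F| ≥ p²); it fails e.g. for F = F_p(t). For other infinite F only a non-singular derivation is claimed. *)

theory Defs
  imports
    Complex_Main
    "HOL-Library.Function_Algebras"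
    "HOL-Library.Product_Plus"
    "HOL-Computational_Algebra.Primes"
begin

section \<open>Lie algebras\<close>

text \<open>
  The Lie algebra is a subspace \<open>L\<close> of an ambient vector space type; the bracket only has to
  satisfy the axioms on \<open>L\<close>.
\<close>

locale lie_algebra = vector_space scale
  for scale :: "'a::field \<Rightarrow> 'l::ab_group_add \<Rightarrow> 'l" +
  fixes L :: "'l set" and bracket :: "'l \<Rightarrow> 'l \<Rightarrow> 'l"
  assumes subspace_carrier: "subspace L"
    and bracket_closed: "\<lbrakk>a \<in> L; b \<in> L\<rbrakk> \<Longrightarrow> bracket a b \<in> L"
    and bracket_add_left:
      "\<lbrakk>a \<in> L; b \<in> L; c \<in> L\<rbrakk> \<Longrightarrow> bracket (a + b) c = bracket a c + bracket b c"
    and bracket_add_right: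
      "\<lbrakk>a \<in> L; b \<in> L; c \<in> L\<rbrakk> \<Longrightarrow> bracket a (b + c) = bracket a b + bracket a c"
    and bracket_scale_left:
      "\<lbrakk>a \<in> L; b \<in> L\<rbrakk> \<Longrightarrow> bracket (scale r a) b = scale r (bracket a b)"
    and bracket_scale_right:
      "\<lbrakk>a \<in> L; b \<in> L\<rbrakk> \<Longrightarrow> bracket a (scale r b) = scale r (bracket a b)"
    and bracket_self: "a \<in> L \<Longrightarrow> bracket a a = 0"
    and jacobi: "\<lbrakk>a \<in> L; b \<in> L; c \<in> L\<rbrakk> \<Longrightarrow>
      bracket a (bracket b c) + bracket b (bracket c a) + bracket c (bracket a b) = 0"
begin

definition bracket_span :: "'l set \<Rightarrow> 'l set \<Rightarrow> 'l set" where
  "bracket_span A B = span {bracket a b | a b. a \<in> A \<and> b \<in> B}"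

text \<open>The lower central series is indexed from \<open>0\<close>: \<open>lower_central n\<close> is usually written
  \<open>\<gamma>\<close> with index \<open>n + 1\<close>.\<close>

primrec lower_central :: "nat \<Rightarrow> 'l set" where
  "lower_central 0 = L"
| "lower_central (Suc n) = bracket_span L (lower_central n)"

primrec derived_series :: "nat \<Rightarrow> 'l set" where
  "derived_series 0 = L"
| "derived_series (Suc n) = bracket_span (derived_series n) (derived_series n)"

definition nilpotent :: bool where
  "nilpotent \<longleftrightarrow> (\<exists>n. lower_central n = {0})"

definition has_nilpotency_class :: "nat \<Rightarrow> bool" where
  "has_nilpotency_class n \<longleftrightarrow> lower_central n = {0} \<and> (\<forall>m<n. lower_central m \<noteq> {0})"

definition has_derived_length :: "nat \<Rightarrow> bool" where
  "has_derived_length n \<longleftrightarrow> derived_series n = {0} \<and> (\<forall>m<n. derived_series m \<noteq> {0})"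

definition subalgebra :: "'l set \<Rightarrow> bool" where
  "subalgebra S \<longleftrightarrow> subspace S \<and> S \<subseteq> L \<and> (\<forall>a\<in>S. \<forall>b\<in>S. bracket a b \<in> S)"

definition generated_subalgebra :: "'l set \<Rightarrow> 'l set" where
  "generated_subalgebra X = subalgebra hull X"

text \<open>Only the restriction of \<open>\<delta>\<close> to \<open>L\<close> matters in the following three notions.\<close>

definition derivation :: "('l \<Rightarrow> 'l) \<Rightarrow> bool" where
  "derivation \<delta> \<longleftrightarrow>
     (\<forall>a\<in>L. \<delta> a \<in> L) \<and>
     (\<forall>a\<in>L. \<forall>b\<in>L. \<delta> (a + b) = \<delta> a + \<delta> b) \<and>
     (\<forall>r. \<forall>a\<in>L. \<delta> (scale r a) = scale r (\<delta> a)) \<and>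
     (\<forall>a\<in>L. \<forall>b\<in>L. \<delta> (bracket a b) = bracket (\<delta> a) b + bracket a (\<delta> b))"

definition nonsingular :: "('l \<Rightarrow> 'l) \<Rightarrow> bool" where
  "nonsingular \<delta> \<longleftrightarrow> bij_betw \<delta> L L"

definition finite_order :: "('l \<Rightarrow> 'l) \<Rightarrow> bool" where
  "finite_order \<delta> \<longleftrightarrow> (\<exists>n\<ge>1. \<forall>a\<in>L. (\<delta> ^^ n) a = a)"

lemma lie_algebra_subalgebra:
  assumes "subalgebra S" shows "lie_algebra scale S bracket"
proof -
  have S: "subspace S" and sub: "\<And>a. a \<in> S \<Longrightarrow> a \<in> L"
    and cl: "\<And>a b. a \<in> S \<Longrightarrow> b \<in> S \<Longrightarrow> bracket a b \<in> S"
    using assms by (auto simp: subalgebra_def)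
  show ?thesis
    by unfold_locales
      (auto simp: S sub cl bracket_add_left bracket_add_right bracket_scale_left
        bracket_scale_right bracket_self jacobi)
qed

lemma subalgebra_generated:
  assumes "X \<subseteq> L" shows "subalgebra (generated_subalgebra X)"
proof -
  have "subalgebra L"
    by (simp add: subalgebra_def subspace_carrier bracket_closed)
  then have "generated_subalgebra X \<subseteq> L"
    unfolding generated_subalgebra_def using assms by (rule hull_minimal[rotated])
  moreover have "subspace (generated_subalgebra X)"
    unfolding generated_subalgebra_def hull_def
    by (rule subspace_Inter) (simp add: subalgebra_def)
  moreover have "\<forall>a\<in>generated_subalgebra X. \<forall>b\<in>generated_subalgebra X.
      bracket a b \<in> generated_subalgebra X"
    unfolding generated_subalgebra_def hull_def by (auto simp: subalgebra_def)
  ultimately show ?thesis by (simp add: subalgebra_def)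
qed

end

section \<open>The general linear Lie algebra and semidirect sums\<close>

definition gl :: "('a::field \<Rightarrow> 'v::ab_group_add \<Rightarrow> 'v) \<Rightarrow> ('v \<Rightarrow> 'v) set" where
  "gl scale = {f. Vector_Spaces.linear scale scale f}"

definition gl_scale :: "('a::field \<Rightarrow> 'v::ab_group_add \<Rightarrow> 'v) \<Rightarrow> 'a \<Rightarrow> ('v \<Rightarrow> 'v) \<Rightarrow> 'v \<Rightarrow> 'v" where
  "gl_scale scale r f = (\<lambda>w. scale r (f w))"

text \<open>The product in \<open>f g - g f\<close> is composition, not the pointwise product of functions.\<close>

definition gl_bracket :: "('v \<Rightarrow> 'v) \<Rightarrow> ('v \<Rightarrow> 'v) \<Rightarrow> 'v \<Rightarrow> 'v::ab_group_add" where
  "gl_bracket f g = (f \<circ> g) - (g \<circ> f)"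

text \<open>For \<open>K \<subseteq> gl scale\<close>, the semidirect sum of \<open>K\<close> with the abelian Lie algebra on the whole
  type \<open>'v\<close> has carrier \<open>semidirect K\<close>.\<close>

definition semidirect :: "('v \<Rightarrow> 'v) set \<Rightarrow> (('v \<Rightarrow> 'v) \<times> 'v) set" where
  "semidirect K = K \<times> UNIV"

definition semidirect_scale ::
  "('a::field \<Rightarrow> 'v::ab_group_add \<Rightarrow> 'v) \<Rightarrow> 'a \<Rightarrow> ('v \<Rightarrow> 'v) \<times> 'v \<Rightarrow> ('v \<Rightarrow> 'v) \<times> 'v" where
  "semidirect_scale scale r a = (gl_scale scale r (fst a), scale r (snd a))"

definition semidirect_bracket ::
  "('v \<Rightarrow> 'v) \<times> 'v \<Rightarrow> ('v \<Rightarrow> 'v) \<times> 'v \<Rightarrow> ('v \<Rightarrow> 'v) \<times> 'v::ab_group_add" where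
  "semidirect_bracket a b =
     (gl_bracket (fst a) (fst b), (fst a) (snd b) - (fst b) (snd a))"

lemma gl_bracket_apply: "gl_bracket f g w = f (g w) - g (f w)"
  by (simp add: gl_bracket_def)

lemma lie_algebra_gl:
  assumes "vector_space scale"
  shows "lie_algebra (gl_scale scale) (gl scale) gl_bracket"
proof -
  interpret V: vector_space scale by fact
  interpret P: vector_space_pair scale scale by unfold_locales
  interpret G: vector_space "gl_scale scale"
    by unfold_locales
      (auto simp: gl_scale_def fun_eq_iff V.scale_right_distrib V.scale_left_distrib)
  have lin: "f \<in> gl scale \<longleftrightarrow>
      (\<forall>a b. f (a + b) = f a + f b) \<and> (\<forall>r a. f (scale r a) = scale r (f a))" for f
    unfolding gl_def
    by (auto simp: linear_iff_module_hom module_hom_iff V.module_axioms)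
  have diff: "f (a - b) = f a - f b" if "f \<in> gl scale" for f a b
    using that unfolding gl_def by (auto intro: P.linear_diff)
  have zero: "f 0 = 0" if "f \<in> gl scale" for f
    using that unfolding gl_def by (auto intro: P.linear_0)
  show ?thesis
  proof unfold_locales
    show "G.subspace (gl scale)"
      by (auto simp: G.subspace_def lin gl_scale_def V.scale_right_distrib algebra_simps
          V.scale_left_commute)
  qed (auto simp: lin diff zero gl_bracket_def gl_scale_def fun_eq_iff V.scale_right_distrib
      V.scale_right_diff_distrib algebra_simps)
qed

lemma lie_algebra_semidirect:
  assumes "vector_space scale" and "lie_algebra (gl_scale scale) K gl_bracket"
    and "K \<subseteq> gl scale"
  shows "lie_algebra (semidirect_scale scale) (semidirect K) semidirect_bracket"
proof -
  interpret V: vector_space scale by fact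
  interpret P: vector_space_pair scale scale by unfold_locales
  interpret K: lie_algebra "gl_scale scale" K gl_bracket by fact
  interpret S: vector_space "semidirect_scale scale"
    by unfold_locales
      (auto simp: semidirect_scale_def gl_scale_def fun_eq_iff prod_eq_iff
        V.scale_right_distrib V.scale_left_distrib)
  have lin: "Vector_Spaces.linear scale scale f" if "f \<in> K" for f
    using that assms(3) by (auto simp: gl_def)
  note lins = P.linear_add[OF lin] P.linear_diff[OF lin] P.linear_scale[OF lin] P.linear_0[OF lin]
  show ?thesis
  proof unfold_locales
    show "S.subspace (semidirect K)"
      using K.subspace_carrier
      by (auto simp: S.subspace_def K.subspace_def semidirect_def semidirect_scale_def
          zero_prod_def)
  next
    fix a b c
    assume "a \<in> semidirect K" "b \<in> semidirect K" "c \<in> semidirect K"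
    then show "semidirect_bracket a (semidirect_bracket b c) +
        semidirect_bracket b (semidirect_bracket c a) +
        semidirect_bracket c (semidirect_bracket a b) = 0"
      using K.jacobi[of "fst a" "fst b" "fst c"]
      by (auto simp: semidirect_def semidirect_bracket_def prod_eq_iff lins)
        (auto simp: gl_bracket_def lins)
  qed (auto simp: semidirect_def semidirect_bracket_def semidirect_scale_def prod_eq_iff lins
      K.bracket_closed K.bracket_add_left K.bracket_add_right
      K.bracket_scale_left[unfolded gl_scale_def] K.bracket_scale_right[unfolded gl_scale_def]
      K.bracket_self V.scale_right_diff_distrib gl_scale_def
      algebra_simps)
qed

section \<open>Subfields\<close>

definition subfield :: "'a::field set \<Rightarrow> bool" where
  "subfield S \<longleftrightarrow> 1 \<in> S \<and> (\<forall>a\<in>S. \<forall>b\<in>S. a - b \<in> S \<and> a * b \<in> S) \<and> (\<forall>a\<in>S. inverse a \<in> S)"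

text \<open>
  A linear map of finite order has only roots of unity as eigenvalues, and each root of unity
  in a field of prime characteristic lies in a finite subfield.  Over an infinite field a lower bound on the
  cardinality of the field therefore gives no control over derivations of finite order (the
  rational function field in one variable over the prime field has no roots of unity outside
  the prime field); a lower bound on the size of the finite subfields does.  For finite fields
  the two bounds are equivalent by \<open>has_finite_subfield_of_size_ge_finite\<close>.
\<close>

definition has_finite_subfield_of_size_ge :: "'a::field itself \<Rightarrow> nat \<Rightarrow> bool" where
  "has_finite_subfield_of_size_ge T q \<longleftrightarrow>
     (\<exists>S::'a set. subfield S \<and> finite S \<and> q \<le> card S)"

lemma has_finite_subfield_of_size_ge_finite:
  assumes "finite (UNIV :: 'a::field set)"
  shows "has_finite_subfield_of_size_ge TYPE('a) q \<longleftrightarrow> q \<le> card (UNIV :: 'a set)"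
proof
  assume "has_finite_subfield_of_size_ge TYPE('a) q"
  then show "q \<le> card (UNIV :: 'a set)"
    unfolding has_finite_subfield_of_size_ge_def
    by (meson assms card_mono order_trans subset_UNIV)
next
  assume "q \<le> card (UNIV :: 'a set)"
  then show "has_finite_subfield_of_size_ge TYPE('a) q"
    using assms unfolding has_finite_subfield_of_size_ge_def
    by (intro exI[of _ UNIV]) (simp add: subfield_def)
qed

end

theory Submission
  imports Defs "HOL-Library.FuncSet"
begin

text \<open>
  Write \<open>ad k\<close> for the \<open>k\<close>-th iterated bracket of \<open>x\<close> with \<open>y\<close>. In characteristic \<open>p\<close> the \<open>p\<close>-th
  power of the adjoint map of \<open>x\<close> is the adjoint map of \<open>x\<^sup>p = id\<close>, so \<open>ad p = 0\<close>. The maps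
  \<open>ad k\<close> send everything into the first block, which they annihilate, so all their products
  vanish and \<open>K\<close> is spanned by \<open>x, ad 0, \<dots>, ad (p - 1)\<close>; parts (1) and (2) are read off from this.

  For part (3), \<open>K\<close> is normalised by linear maps \<open>E\<close> of the form \<open>D - s x\<close>, where \<open>D\<close> is diagonal
  with entries \<open>\<beta> + j\<close> on the first and \<open>j\<close> on the second block, and the derivation is induced by such
  an \<open>E\<close>. Its restriction to \<open>K\<close> is triangular with diagonal \<open>1, \<beta>, \<beta> + 1, \<dots>\<close>, and \<open>E\<close> is
  invertible iff \<open>s\<^sup>p\<close> differs from the product of the diagonal entries of each block. The inner
  part \<open>s x\<close> is what makes this possible over the field with four elements, where no diagonal \<open>E\<close>
  gives a non-singular derivation. If \<open>\<beta>\<close> and \<open>s\<close> lie in a finite subfield, then the derivation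
  permutes a finite set of vectors spanning \<open>L\<close>, hence has finite order.
\<close>

section \<open>Linear maps of finite order\<close>

text \<open>By pigeonhole two powers of \<open>f\<close> agree on \<open>M\<close>; injectivity
  cancels the smaller one.\<close>

lemma inj_on_finite_funpow_id:
  fixes f :: "'a \<Rightarrow> 'a"
  assumes "finite M" "f ` M \<subseteq> M" "inj_on f M"
  shows "\<exists>n\<ge>1. \<forall>a\<in>M. (f ^^ n) a = a"
proof -
  have mem: "(f ^^ n) a \<in> M" if "a \<in> M" for n a
    using that assms(2) by (induct n) auto
  have inj: "inj_on (f ^^ n) M" for n
  proof (induct n)
    case (Suc n)
    then show ?case
      using assms(3) mem by (auto simp: inj_on_def)
  qed simp
  let ?F = "\<lambda>n. restrict (f ^^ n) M"
  have "range ?F \<subseteq> M \<rightarrow>\<^sub>E M"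
    using mem by auto
  then have "finite (range ?F)"
    using assms(1) by (meson finite_PiE finite_subset)
  then have "\<not> inj ?F"
    using finite_imageD infinite_UNIV_nat by blast
  then obtain m n where "m < n" "?F m = ?F n"
    unfolding inj_on_def by (metis linorder_neqE_nat)
  then have eq: "(f ^^ m) a = (f ^^ n) a" if "a \<in> M" for a
    using that by (metis restrict_apply')
  have "(f ^^ (n - m)) a = a" if "a \<in> M" for a
  proof -
    have "(f ^^ m) ((f ^^ (n - m)) a) = (f ^^ m) a"
      using eq[OF that] \<open>m < n\<close> by (simp flip: funpow_add o_apply[of "f ^^ m"])
    then show ?thesis
      using inj[of m] mem that by (auto dest: inj_onD)
  qed
  then show ?thesis
    using \<open>m < n\<close> by (intro exI[of _ "n - m"]) auto
qed

lemma funpow_map_prod: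
  fixes f :: "'a \<Rightarrow> 'a" and g :: "'b \<Rightarrow> 'b"
  shows "map_prod f g ^^ n = map_prod (f ^^ n) (g ^^ n)"
  by (induct n) (auto simp: fun_eq_iff)

text \<open>Reduces membership of a linear image to generators of a span; applied below to maps on
  vectors, to brackets and to evaluation at a vector.\<close>

lemma (in vector_space_pair) linear_mem_if_mem_span:
  assumes "Vector_Spaces.linear s1 s2 f" and "a \<in> vs1.span B"
    and "\<And>b. b \<in> B \<Longrightarrow> f b \<in> S" and "vs2.subspace S"
  shows "f a \<in> S"
  using assms(2)
proof (induct rule: vs1.span_induct)
  case base
  show ?case
    using assms(1,4) by (rule linear_subspace_vimage[unfolded vimage_def])
qed (use assms(3) in auto)

lemma subfield_closed:
  assumes "subfield S"
  shows "0 \<in> S" "1 \<in> S" "a \<in> S \<Longrightarrow> b \<in> S \<Longrightarrow> a + b \<in> S" "a \<in> S \<Longrightarrow> b \<in> S \<Longrightarrow> a * b \<in> S"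
    "a \<in> S \<Longrightarrow> - a \<in> S" "of_nat n \<in> S"
proof -
  show one: "1 \<in> S"
    using assms by (simp add: subfield_def)
  show zero: "0 \<in> S"
    using assms one by (metis subfield_def diff_self)
  show neg: "- a \<in> S" if "a \<in> S" for a
    using assms zero that by (metis subfield_def diff_0)
  show add: "a + b \<in> S" if "a \<in> S" "b \<in> S" for a b
    using assms neg that by (metis subfield_def diff_minus_eq_add)
  show "a * b \<in> S" if "a \<in> S" "b \<in> S" for a b
    using assms that by (simp add: subfield_def)
  show "of_nat n \<in> S"
    by (induct n) (auto simp: zero one add)
qed

lemma (in vector_space) linear_funpow:
  fixes f :: "'b \<Rightarrow> 'b"
  assumes "Vector_Spaces.linear scale scale f"
  shows "Vector_Spaces.linear scale scale (f ^^ n)"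
proof (induct n)
  case 0
  show ?case using linear_id by (simp add: id_def)
next
  case (Suc n)
  then show ?case
    using Vector_Spaces.linear_compose[OF Suc assms] by (simp add: comp_def)
qed

text \<open>Such an \<open>f\<close> permutes the finite set of combinations of \<open>B\<close> with coefficients in \<open>S\<close>.\<close>

lemma (in vector_space) linear_finite_order:
  fixes f :: "'b \<Rightarrow> 'b"
  assumes lin: "Vector_Spaces.linear scale scale f"
    and "finite B" "finite S" "subfield S"
    and stable: "\<And>b. b \<in> B \<Longrightarrow> \<exists>c\<in>B \<rightarrow> S. f b = (\<Sum>b\<in>B. scale (c b) b)"
    and inj: "inj_on f (span B)"
  shows "\<exists>n\<ge>1. \<forall>a\<in>span B. (f ^^ n) a = a"
proof -
  interpret P: vector_space_pair scale scale by unfold_locales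
  note S = subfield_closed[OF \<open>subfield S\<close>]
  define comb where "comb c = (\<Sum>b\<in>B. scale (c b) b)" for c
  define M where "M = comb ` (B \<rightarrow> S)"
  have "comb c \<in> comb ` (B \<rightarrow>\<^sub>E S)" if "c \<in> B \<rightarrow> S" for c
    using that by (intro image_eqI[of _ _ "restrict c B"])
      (auto simp: comb_def intro!: sum.cong)
  then have "M \<subseteq> comb ` (B \<rightarrow>\<^sub>E S)"
    by (auto simp: M_def)
  then have fin: "finite M"
    using assms by (meson finite_PiE finite_imageI finite_subset)
  have zero: "0 \<in> M"
    unfolding M_def by (rule image_eqI[of _ _ "\<lambda>_. 0"]) (auto simp: comb_def S)
  have add: "a + b \<in> M" if "a \<in> M" "b \<in> M" for a b
  proof -
    obtain c d where "c \<in> B \<rightarrow> S" "d \<in> B \<rightarrow> S" "a = comb c" "b = comb d"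
      using \<open>a \<in> M\<close> \<open>b \<in> M\<close> unfolding M_def by blast
    then show ?thesis
      unfolding M_def by (intro image_eqI[of _ _ "\<lambda>b. c b + d b"])
        (auto simp: comb_def S Pi_iff sum.distrib scale_left_distrib)
  qed
  have scl: "scale r a \<in> M" if "a \<in> M" "r \<in> S" for a r
  proof -
    obtain c where "c \<in> B \<rightarrow> S" "a = comb c"
      using \<open>a \<in> M\<close> unfolding M_def by blast
    then show ?thesis
      unfolding M_def using \<open>r \<in> S\<close> by (intro image_eqI[of _ _ "\<lambda>b. r * c b"])
        (auto simp: comb_def S Pi_iff scale_sum_right)
  qed
  have base: "b \<in> M" if "b \<in> B" for b
    unfolding M_def using that \<open>finite B\<close>
    by (intro image_eqI[of _ _ "\<lambda>a. if a = b then 1 else 0"])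
      (auto simp: comb_def S if_distrib[of "\<lambda>r. scale r _"] cong: if_cong)
  have sub: "M \<subseteq> span B"
    by (auto simp: M_def comb_def intro!: span_sum span_scale intro: span_base)
  have sum_mem: "(\<Sum>b\<in>A. scale (c b) (g b)) \<in> M"
    if "finite A" "\<And>b. b \<in> A \<Longrightarrow> c b \<in> S \<and> g b \<in> M" for A c and g :: "'b \<Rightarrow> 'b"
    using that by (induct A) (auto intro!: zero add scl)
  have "f (comb c) \<in> M" if "c \<in> B \<rightarrow> S" for c
  proof -
    have "f (comb c) = (\<Sum>b\<in>B. scale (c b) (f b))"
      by (simp add: comb_def P.linear_sum[OF lin] P.linear_scale[OF lin])
    moreover have "f b \<in> M" if "b \<in> B" for b
      using stable[OF that] by (auto simp: M_def comb_def)
    ultimately show ?thesis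
      using sum_mem[OF \<open>finite B\<close>, of c f] that by auto
  qed
  then have "f ` M \<subseteq> M"
    by (auto simp: M_def)
  then obtain n where n: "n \<ge> 1" "\<And>a. a \<in> M \<Longrightarrow> (f ^^ n) a = a"
    using inj_on_finite_funpow_id[OF fin] inj sub by (metis inj_on_subset)
  have "Vector_Spaces.linear scale scale (f ^^ n)"
    using lin by (rule linear_funpow)
  then have "(f ^^ n) a = a" if "a \<in> span B" for a
    using P.linear_eq_on[OF _ linear_id] that n(2) base by (metis id_apply)
  then show ?thesis
    using n(1) by blast
qed

text \<open>Serves the hypothesis \<open>stable\<close> of \<open>linear_finite_order\<close> for
  maps that send a basis vector to a combination of itself and its successor. The option
  \<open>b = 0\<close> covers the end of a chain.\<close>

lemma (in vector_space) two_term_combination: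
  assumes "finite B" "subfield S" "a \<in> B" "b \<in> B \<or> b = 0" "r \<in> S" "t \<in> S"
  shows "\<exists>c\<in>B \<rightarrow> S. scale r a + scale t b = (\<Sum>b\<in>B. scale (c b) b)"
proof -
  note S = subfield_closed[OF \<open>subfield S\<close>]
  have single: "\<exists>c\<in>B \<rightarrow> S. scale r a = (\<Sum>b\<in>B. scale (c b) b)"
    if "a \<in> B \<or> a = 0" "r \<in> S" for r a
  proof (cases "a \<in> B")
    case True
    then show ?thesis
      using \<open>r \<in> S\<close> \<open>finite B\<close> by (intro bexI[of _ "\<lambda>b. if b = a then r else 0"])
        (auto simp: S if_distrib[of "\<lambda>r. scale r _"] cong: if_cong)
  next
    case False
    then show ?thesis
      using that by (intro bexI[of _ "\<lambda>_. 0"]) (auto simp: S)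
  qed
  obtain c d where "c \<in> B \<rightarrow> S" "d \<in> B \<rightarrow> S"
    "scale r a = (\<Sum>b\<in>B. scale (c b) b)" "scale t b = (\<Sum>b\<in>B. scale (d b) b)"
    using single[of a r] single[of b t] assms by blast
  then show ?thesis
    by (intro bexI[of _ "\<lambda>b. c b + d b"])
      (auto simp: S Pi_iff scale_left_distrib sum.distrib)
qed

text \<open>The relations say \<open>s * e (j + 1) = a j * e j\<close> modulo \<open>R\<close>; going once around the cycle
  gives \<open>s ^ p * e 0 = (\<Prod>j<p. a j) * e 0\<close>.\<close>

lemma (in vector_space) cycle_mem_subspace:
  assumes "subspace R" and R: "\<And>j. scale (a j) (e j) - scale s (e (Suc j)) \<in> R"
    and "e p = e 0" "s \<noteq> 0" "s ^ p \<noteq> (\<Prod>j<p. a j)"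
  shows "e j \<in> R"
proof -
  have step: "scale (s ^ n) (e n) - scale (\<Prod>j<n. a j) (e 0) \<in> R" for n
  proof (induct n)
    case 0
    show ?case
      using subspace_0[OF \<open>subspace R\<close>] by simp
  next
    case (Suc n)
    have "scale (s ^ Suc n) (e (Suc n)) - scale (\<Prod>j<Suc n. a j) (e 0) =
      scale (a n) (scale (s ^ n) (e n) - scale (\<Prod>j<n. a j) (e 0)) -
      scale (s ^ n) (scale (a n) (e n) - scale s (e (Suc n)))"
      by (simp add: scale_right_diff_distrib mult.commute)
    then show ?case
      using Suc R[of n] \<open>subspace R\<close> by (simp only: subspace_diff subspace_scale)
  qed
  \<comment> \<open>As \<open>e p = e 0\<close>, one full turn leaves \<open>e 0\<close> times a
    nonzero scalar, which can be divided out.\<close>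
  have "scale (s ^ p - (\<Prod>j<p. a j)) (e 0) \<in> R"
    using step[of p] \<open>e p = e 0\<close> by (simp add: scale_left_diff_distrib)
  then have "scale (inverse (s ^ p - (\<Prod>j<p. a j))) (scale (s ^ p - (\<Prod>j<p. a j)) (e 0)) \<in> R"
    using \<open>subspace R\<close> subspace_scale by blast
  then have e0: "e 0 \<in> R"
    using \<open>s ^ p \<noteq> (\<Prod>j<p. a j)\<close> by simp
  have "scale (s ^ j) (e j) \<in> R"
    using subspace_add[OF \<open>subspace R\<close> step[of j] subspace_scale[OF \<open>subspace R\<close> e0,
        of "\<Prod>i<j. a i"]] by simp
  then have "scale (inverse (s ^ j)) (scale (s ^ j) (e j)) \<in> R"
    using \<open>subspace R\<close> subspace_scale by blast
  then show ?thesis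
    using \<open>s \<noteq> 0\<close> by simp
qed

lemma funpow_fixed_mult:
  fixes f :: "'a \<Rightarrow> 'a"
  assumes "(f ^^ m) a = a"
  shows "(f ^^ (m * n)) a = a"
proof -
  have "((f ^^ m) ^^ n) a = a"
    using assms by (induct n) auto
  then show ?thesis
    by (simp add: funpow_mult)
qed

section \<open>Iterated brackets\<close>

lemma (in lie_algebra) bracket_in_bracket_span:
  "a \<in> A \<Longrightarrow> b \<in> B \<Longrightarrow> bracket a b \<in> bracket_span A B"
  unfolding bracket_span_def by (rule span_base) blast

lemma (in lie_algebra) bracket_span_minimal:
  assumes "\<And>a b. a \<in> A \<Longrightarrow> b \<in> B \<Longrightarrow> bracket a b \<in> T" and "subspace T"
  shows "bracket_span A B \<subseteq> T"
  unfolding bracket_span_def using assms by (intro span_minimal) auto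

text \<open>The adjoint map of \<open>x\<close> is the difference of left and right multiplication
  by \<open>x\<close>, which commute, so its powers follow the binomial theorem.\<close>

lemma gl_bracket_funpow:
  fixes scale :: "'a::field \<Rightarrow> 'v::ab_group_add \<Rightarrow> 'v"
  assumes "vector_space scale"
    and x: "Vector_Spaces.linear scale scale x"
  shows "(gl_bracket x ^^ n) y u = (\<Sum>j\<le>n. scale ((- 1) ^ j * of_nat (n choose j))
    ((x ^^ (n - j)) (y ((x ^^ j) u))))"
proof (induct n arbitrary: u)
  interpret vector_space scale by fact
  case 0
  show ?case by simp
next
  interpret vector_space scale by fact
  interpret P: vector_space_pair scale scale by unfold_locales
  case (Suc n)
  define c where "c n j = ((- 1) ^ j * of_nat (n choose j) :: 'a)" for n j
  define t where "t j = (x ^^ (Suc n - j)) (y ((x ^^ j) u))" for j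
  have c_Suc: "c (Suc n) (Suc j) = c n (Suc j) - c n j" for j
    by (simp add: c_def algebra_simps)
  have "x ((gl_bracket x ^^ n) y u) = (\<Sum>j\<le>n. scale (c n j) (t j))"
    unfolding Suc by (auto simp: P.linear_sum[OF x] P.linear_scale[OF x] c_def t_def Suc_diff_le
        intro!: sum.cong)
  \<comment> \<open>The extra term vanishes since \<open>n choose Suc n = 0\<close>; it lets the
    index shift line up both sums for Pascal's rule \<open>c_Suc\<close>.\<close>
  also have "\<dots> = (\<Sum>j\<le>Suc n. scale (c n j) (t j))"
    by (simp add: c_def binomial_eq_0)
  also have "\<dots> = scale (c n 0) (t 0) + (\<Sum>j\<le>n. scale (c n (Suc j)) (t (Suc j)))"
    by (rule sum.atMost_Suc_shift)
  finally have "x ((gl_bracket x ^^ n) y u) =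
    scale (c n 0) (t 0) + (\<Sum>j\<le>n. scale (c n (Suc j)) (t (Suc j)))" .
  moreover have "(gl_bracket x ^^ n) y (x u) = (\<Sum>j\<le>n. scale (c n j) (t (Suc j)))"
    unfolding Suc by (auto simp: c_def t_def funpow_swap1 intro!: sum.cong)
  ultimately have "(gl_bracket x ^^ Suc n) y u =
    scale (c (Suc n) 0) (t 0) + (\<Sum>j\<le>n. scale (c (Suc n) (Suc j)) (t (Suc j)))"
    by (simp add: gl_bracket_apply c_Suc scale_left_diff_distrib sum_subtractf)
      (simp add: c_def)
  also have "\<dots> = (\<Sum>j\<le>Suc n. scale (c (Suc n) j) (t j))"
    by (rule sum.atMost_Suc_shift[symmetric])
  finally show ?case
    by (simp add: c_def t_def)
qed

section \<open>The Lie algebra generated by the shift\<close>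

locale shift_module = vector_space scale
  for scale :: "'a::field \<Rightarrow> 'v::ab_group_add \<Rightarrow> 'v" +
  fixes p :: nat and v :: "nat \<Rightarrow> 'v" and x y :: "'v \<Rightarrow> 'v"
  assumes prime_p: "prime p" and char_p: "CHAR('a) = p"
    and inj_v: "inj_on v {1..2*p}"
    and independent_v: "independent (v ` {1..2*p})"
    and span_v: "span (v ` {1..2*p}) = UNIV"
    and linear_x: "Vector_Spaces.linear scale scale x"
    and x_v: "\<And>i. i \<in> {1..p-1} \<Longrightarrow> x (v i) = v (i + 1)" "x (v p) = v 1"
      "\<And>i. i \<in> {1..p-1} \<Longrightarrow> x (v (p + i)) = v (p + i + 1)" "x (v (2*p)) = v (p + 1)"
    and linear_y: "Vector_Spaces.linear scale scale y"
    and y_v: "y (v (p + 1)) = v 1" "\<And>i. i \<in> {1..2*p} \<Longrightarrow> i \<noteq> p + 1 \<Longrightarrow> y (v i) = 0"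
begin

sublocale P: vector_space_pair scale scale
  by unfold_locales

sublocale G: lie_algebra "gl_scale scale" "gl scale" gl_bracket
  by (rule lie_algebra_gl) unfold_locales

sublocale GG: vector_space_pair "gl_scale scale" "gl_scale scale"
  by unfold_locales

sublocale GV: vector_space_pair "gl_scale scale" scale
  by unfold_locales

lemmas x_linear [simp] =
  P.linear_add[OF linear_x] P.linear_diff[OF linear_x] P.linear_scale[OF linear_x]
  P.linear_0[OF linear_x] P.linear_neg[OF linear_x]

lemmas y_linear [simp] =
  P.linear_add[OF linear_y] P.linear_diff[OF linear_y] P.linear_scale[OF linear_y]
  P.linear_0[OF linear_y] P.linear_neg[OF linear_y]

lemma two_le_p: "2 \<le> p"
  using prime_p by (rule prime_ge_2_nat)

lemma of_nat_p [simp]: "of_nat p = (0::'a)"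
  using of_nat_CHAR[where 'a = 'a] by (simp add: char_p)

text \<open>The two cycles of \<open>x\<close>, with indices taken modulo \<open>p\<close> and starting at \<open>0\<close>.\<close>

definition lo :: "nat \<Rightarrow> 'v" where
  "lo j = v (1 + j mod p)"

definition hi :: "nat \<Rightarrow> 'v" where
  "hi j = v (p + 1 + j mod p)"

lemma mod_p_less [simp]: "j mod p < p"
  using two_le_p by simp

lemma x_lo [simp]: "x (lo j) = lo (Suc j)"
proof (cases "Suc (j mod p) = p")
  case True
  then show ?thesis
    using x_v(2) by (simp add: lo_def mod_Suc)
next
  case False
  then have "1 + j mod p \<in> {1..p-1}"
    using mod_p_less[of j] by (simp del: mod_p_less)
  then show ?thesis
    using x_v(1)[of "1 + j mod p"] False by (simp add: lo_def mod_Suc)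
qed

lemma x_hi [simp]: "x (hi j) = hi (Suc j)"
proof (cases "Suc (j mod p) = p")
  case True
  then have "p + 1 + j mod p = 2 * p"
    by simp
  then have "hi j = v (2 * p)"
    by (simp only: hi_def)
  then show ?thesis
    using x_v(4) True by (simp add: hi_def mod_Suc)
next
  case False
  then have "1 + j mod p \<in> {1..p-1}"
    using mod_p_less[of j] by (simp del: mod_p_less)
  then show ?thesis
    using x_v(3)[of "1 + j mod p"] False by (simp add: hi_def mod_Suc)
qed

lemma lo_add_p [simp]: "lo (j + p) = lo j" and hi_add_p [simp]: "hi (j + p) = hi j"
  by (simp_all add: lo_def hi_def)

lemma lo_mod_p [simp]: "lo (j mod p) = lo j" and hi_mod_p [simp]: "hi (j mod p) = hi j"
  by (simp_all add: lo_def hi_def)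

lemma lo_p [simp]: "lo p = lo 0" and hi_p [simp]: "hi p = hi 0"
  using lo_add_p[of 0] hi_add_p[of 0] by simp_all

lemma y_lo [simp]: "y (lo j) = 0"
  unfolding lo_def using mod_p_less[of j] by (intro y_v(2)) (auto simp del: mod_p_less)

lemma y_hi [simp]: "y (hi j) = (if j mod p = 0 then lo 0 else 0)"
proof (cases "j mod p = 0")
  case False
  then show ?thesis
    unfolding hi_def using y_v(2)[of "p + 1 + j mod p"] mod_p_less[of j] by simp
qed (use y_v(1) in \<open>simp add: lo_def hi_def\<close>)

lemma image_v: "v ` {1..2*p} = lo ` {..<p} \<union> hi ` {..<p}"
proof -
  have "{1..2*p} = (\<lambda>j. 1 + j) ` {..<p} \<union> (\<lambda>j. p + 1 + j) ` {..<p}"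
  proof (intro equalityI subsetI)
    fix i assume "i \<in> {1..2*p}"
    then show "i \<in> (\<lambda>j. 1 + j) ` {..<p} \<union> (\<lambda>j. p + 1 + j) ` {..<p}"
      by (cases "i \<le> p") (auto intro: image_eqI[of _ _ "i - 1"] image_eqI[of _ _ "i - (p + 1)"])
  qed auto
  then have "v ` {1..2*p} = (\<lambda>j. v (1 + j)) ` {..<p} \<union> (\<lambda>j. v (p + 1 + j)) ` {..<p}"
    by (simp add: image_Un image_image)
  also have "(\<lambda>j. v (1 + j)) ` {..<p} = lo ` {..<p}"
    by (rule image_cong) (auto simp: lo_def)
  also have "(\<lambda>j. v (p + 1 + j)) ` {..<p} = hi ` {..<p}"
    by (rule image_cong) (auto simp: hi_def)
  finally show ?thesis .
qed

lemma span_lo_hi: "span (lo ` {..<p} \<union> hi ` {..<p}) = UNIV"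
  using span_v unfolding image_v .

lemma linear_eqI:
  assumes "Vector_Spaces.linear scale scale f" "Vector_Spaces.linear scale scale g"
    and "\<And>j. f (lo j) = g (lo j)" "\<And>j. f (hi j) = g (hi j)"
  shows "f = g"
proof
  fix a
  show "f a = g a"
    using assms by (intro P.linear_eq_on[OF assms(1,2), of a "lo ` {..<p} \<union> hi ` {..<p}"])
      (auto simp: span_lo_hi)
qed

lemma linear_exists:
  "\<exists>f. Vector_Spaces.linear scale scale f \<and> (\<forall>j<p. f (lo j) = a j \<and> f (hi j) = b j)"
proof -
  define g where "g i = (if i \<le> p then a (i - 1) else b (i - (p + 1)))" for i
  obtain f where f: "Vector_Spaces.linear scale scale f"
    "\<And>u. u \<in> v ` {1..2*p} \<Longrightarrow> f u = g (the_inv_into {1..2*p} v u)"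
    using P.linear_independent_extend[OF independent_v, of "g \<circ> the_inv_into {1..2*p} v"] by auto
  then have "f (v i) = g i" if "i \<in> {1..2*p}" for i
    using that inj_v by (simp add: the_inv_into_f_f)
  then have "\<forall>j<p. f (lo j) = a j \<and> f (hi j) = b j"
    by (auto simp: lo_def hi_def g_def)
  then show ?thesis
    using f(1) by blast
qed

text \<open>Together with \<open>ad_hi_0\<close> this yields the independence of the maps
  \<open>ad k\<close>, by evaluation at \<open>hi 0\<close>.\<close>

lemma lo_notin_span:
  assumes "k < p"
  shows "lo k \<notin> span (lo ` {..<k})"
proof
  assume "lo k \<in> span (lo ` {..<k})"
  moreover have "lo ` {..<k} \<subseteq> v ` {1..2*p} - {lo k}"
  proof -
    have "lo j \<noteq> lo k" if "j < k" for j
      using inj_onD[OF inj_v, of "1 + j" "1 + k"] that assms by (auto simp: lo_def)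
    then show ?thesis
      using assms unfolding image_v by auto
  qed
  ultimately have "lo k \<in> span (v ` {1..2*p} - {lo k})"
    using span_mono by blast
  moreover have "lo k \<in> v ` {1..2*p}"
    using assms unfolding image_v by auto
  ultimately show False
    using independent_v by (auto simp: dependent_def)
qed

lemma lo_neq_0 [simp]: "lo k \<noteq> 0"
proof
  assume "lo k = 0"
  then have "lo (k mod p) \<in> span (lo ` {..<k mod p})"
    by (simp add: span_zero)
  then show False
    using lo_notin_span[of "k mod p"] by simp
qed

lemma x_funpow_lo: "(x ^^ n) (lo j) = lo (j + n)" and x_funpow_hi: "(x ^^ n) (hi j) = hi (j + n)"
  by (induct n) auto

text \<open>Shifting by \<open>p\<close> is trivial on both cycles. This makes \<open>ad p\<close>
  vanish and \<open>x\<close> invertible; the latter keeps \<open>L\<close> from being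
  nilpotent.\<close>

lemma x_funpow_p: "x ^^ p = id"
  by (rule linear_eqI) (auto simp: linear_funpow[OF linear_x] linear_id x_funpow_lo x_funpow_hi)

section \<open>Iterated brackets of \<open>x\<close> with \<open>y\<close> and their action on the
  two cycles\<close>

definition ad :: "nat \<Rightarrow> 'v \<Rightarrow> 'v" where
  "ad k = (gl_bracket x ^^ k) y"

lemma ad_0 [simp]: "ad 0 = y"
  by (simp add: ad_def)

lemma bracket_x_ad [simp]: "gl_bracket x (ad k) = ad (Suc k)"
  by (simp add: ad_def)

lemma ad_Suc_apply: "ad (Suc k) u = x (ad k u) - ad k (x u)"
  by (simp add: gl_bracket_apply flip: bracket_x_ad)

lemma x_in_gl [simp]: "x \<in> gl scale" and y_in_gl [simp]: "y \<in> gl scale"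
  by (simp_all add: gl_def linear_x linear_y)

lemma ad_in_gl [simp]: "ad k \<in> gl scale"
  by (induct k) (auto simp: G.bracket_closed simp flip: bracket_x_ad)

lemma ad_lo [simp]: "ad k (lo j) = 0"
  by (induct k arbitrary: j) (auto simp: ad_Suc_apply)

text \<open>Expanding \<open>ad k\<close>, the map \<open>y\<close> is only ever applied to some
  \<open>hi (j + i)\<close> with \<open>i \<le> k\<close>, and it kills these because
  \<open>0 < j + i < p\<close>.\<close>

lemma ad_hi_eq_0: "1 \<le> j \<Longrightarrow> j + k < p \<Longrightarrow> ad k (hi j) = 0"
  by (induct k arbitrary: j) (auto simp: ad_Suc_apply)

text \<open>The part \<open>ad k (x (hi 0))\<close> of the recursion vanishes by
  \<open>ad_hi_eq_0\<close>, so each bracket applies \<open>x\<close> once more to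
  \<open>y (hi 0) = lo 0\<close>.\<close>

lemma ad_hi_0: "k < p \<Longrightarrow> ad k (hi 0) = lo k"
  by (induct k) (auto simp: ad_Suc_apply ad_hi_eq_0)

lemma ad_in_span_lo: "ad k u \<in> span (range lo)"
proof (induct k arbitrary: u)
  case 0
  have "y u \<in> span (range lo)"
    by (rule P.linear_mem_if_mem_span[OF linear_y, of _ "lo ` {..<p} \<union> hi ` {..<p}"])
      (auto simp: span_lo_hi span_zero span_base)
  then show ?case by simp
next
  case (Suc k)
  have "x a \<in> span (range lo)" if "a \<in> span (range lo)" for a
    by (rule P.linear_mem_if_mem_span[OF linear_x that]) (auto intro: span_base)
  then show ?case
    using Suc by (simp add: ad_Suc_apply span_diff)
qed

text \<open>In characteristic \<open>p\<close> one has \<open>ad(x)\<^sup>p = ad(x\<^sup>p)\<close>, and here \<open>x\<^sup>p = id\<close> is central.\<close>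

lemma ad_p: "ad p = 0"
proof
  fix u
  let ?t = "\<lambda>j. scale ((- 1) ^ j * of_nat (p choose j)) ((x ^^ (p - j)) (y ((x ^^ j) u)))"
  have "ad p u = (\<Sum>j\<le>p. ?t j)"
    unfolding ad_def by (rule gl_bracket_funpow[OF vector_space_axioms linear_x])
  \<comment> \<open>The inner binomial coefficients are divisible by \<open>p\<close>; by
    \<open>x_funpow_p\<close> the end terms are \<open>y u\<close> and \<open>(- 1) ^ p\<close>
    times \<open>y u\<close>.\<close>
  also have "\<dots> = (\<Sum>j\<in>{0, p}. ?t j)"
  proof (rule sum.mono_neutral_right)
    show "\<forall>j\<in>{..p} - {0, p}. ?t j = 0"
    proof
      fix j assume "j \<in> {..p} - {0, p}"
      then have "p dvd (p choose j)"
        by (intro dvd_choose_prime) (use prime_p in auto)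
      then have "of_nat (p choose j) = (0::'a)"
        by (simp add: of_nat_eq_0_iff_char_dvd char_p)
      then show "?t j = 0"
        by simp
    qed
  qed auto
  also have "\<dots> = scale (1 + (- 1) ^ p) (y u)"
    using two_le_p by (simp add: x_funpow_p scale_left_distrib)
  also have "1 + (- 1) ^ p = (0::'a)"
  proof (cases "p = 2")
    case True
    then have "1 + (- 1) ^ p = (of_nat p :: 'a)"
      by simp
    then show ?thesis by simp
  next
    case False
    then have "odd p"
      using prime_p two_le_p prime_odd_nat[of p] by simp
    then show ?thesis by simp
  qed
  finally show "ad p u = 0 u"
    by simp
qed

lemma ad_eq_0:
  assumes "p \<le> k"
  shows "ad k = 0"
  using assms
proof (induct k rule: dec_induct)
  case (step k)
  then show ?case
    by (simp add: gl_bracket_def fun_eq_iff flip: bracket_x_ad)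
qed (rule ad_p)

lemma ad_neq_0: "k < p \<Longrightarrow> ad k \<noteq> 0"
  using ad_hi_0[of k] lo_neq_0[of k] by (metis zero_fun_apply)

section \<open>The filtration \<open>N\<close> spanned by the iterated brackets\<close>

lemma linear_bracket:
  assumes "Vector_Spaces.linear scale scale f"
  shows "Vector_Spaces.linear (gl_scale scale) (gl_scale scale) (gl_bracket f)"
  using G.vector_space_axioms
  by (auto simp: Vector_Spaces.linear_iff gl_bracket_def gl_scale_def fun_eq_iff
      P.linear_add[OF assms] P.linear_scale[OF assms] scale_right_diff_distrib)

lemma linear_apply: "Vector_Spaces.linear (gl_scale scale) scale (\<lambda>f. f u)"
  using G.vector_space_axioms vector_space_axioms
  by (auto simp: Vector_Spaces.linear_iff gl_scale_def)

text \<open>\<open>N 0\<close> is an abelian ideal of \<open>K\<close> complementing the line of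
  \<open>x\<close>; for \<open>m \<ge> 1\<close>, \<open>N m\<close> is a term of the lower central
  series. Letting the index run over all \<open>k \<ge> m\<close> avoids case distinctions at
  \<open>p\<close>.\<close>

definition N :: "nat \<Rightarrow> ('v \<Rightarrow> 'v) set" where
  "N m = G.span (ad ` {m..})"

lemma subspace_N [simp]: "G.subspace (N m)"
  by (simp add: N_def)

lemma ad_in_N: "m \<le> k \<Longrightarrow> ad k \<in> N m"
  by (auto simp: N_def intro: G.span_base)

lemma N_antimono: "m \<le> n \<Longrightarrow> N n \<subseteq> N m"
  unfolding N_def by (intro G.span_mono) auto

lemma N_p: "N p = {0}"
proof -
  have "ad ` {p..} = {0}"
    using ad_eq_0 by auto
  then show ?thesis
    using G.span_insert_0[of "{}"] by (simp add: N_def del: G.span_insert_0)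
qed

lemma N_in_gl: "N m \<subseteq> gl scale"
  unfolding N_def by (intro G.span_minimal) (auto simp: G.subspace_carrier)

lemma bracket_x_N: "g \<in> N m \<Longrightarrow> gl_bracket x g \<in> N (Suc m)"
  unfolding N_def
  by (erule GG.linear_mem_if_mem_span[OF linear_bracket[OF linear_x]])
    (auto intro!: G.span_base)

lemma N_in_span_lo: "g \<in> N 0 \<Longrightarrow> g u \<in> span (range lo)"
  unfolding N_def
  by (erule GV.linear_mem_if_mem_span[OF linear_apply]) (auto simp: ad_in_span_lo)

lemma linear_N: "g \<in> N m \<Longrightarrow> Vector_Spaces.linear scale scale g"
  using N_in_gl by (auto simp: gl_def)

lemma N_on_span_lo:
  assumes "g \<in> N 0" "u \<in> span (range lo)"
  shows "g u = 0"
proof -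
  have "g (lo j) \<in> {0}" for j
    using assms(1) unfolding N_def
    by (rule GV.linear_mem_if_mem_span[OF linear_apply]) (auto simp: subspace_single_0)
  then have "g u \<in> {0}"
    by (intro P.linear_mem_if_mem_span[OF linear_N[OF assms(1)] assms(2)]) auto
  then show ?thesis by simp
qed

lemma N_comp_N: "g \<in> N 0 \<Longrightarrow> h \<in> N 0 \<Longrightarrow> g (h u) = 0"
  by (simp add: N_on_span_lo N_in_span_lo)

section \<open>The Lie algebra \<open>K\<close>, a basis and its dimension\<close>

definition K :: "('v \<Rightarrow> 'v) set" where
  "K = G.generated_subalgebra {x, y}"

lemma subalgebra_K: "G.subalgebra K"
  unfolding K_def by (rule G.subalgebra_generated) auto

lemma K_in_gl: "K \<subseteq> gl scale"
  using subalgebra_K by (simp add: G.subalgebra_def)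

sublocale K: lie_algebra "gl_scale scale" K gl_bracket
  by (rule G.lie_algebra_subalgebra[OF subalgebra_K])

sublocale L: lie_algebra "semidirect_scale scale" "semidirect K" semidirect_bracket
  by (rule lie_algebra_semidirect[OF vector_space_axioms K.lie_algebra_axioms K_in_gl])

text \<open>Products within \<open>N 0\<close> vanish and \<open>x\<close> commutes with itself, so
  only the mixed brackets survive.\<close>

lemma bracket_K:
  assumes "g \<in> N 0" "h \<in> N 0"
  shows "gl_bracket (gl_scale scale a x + g) (gl_scale scale b x + h) =
    gl_scale scale a (gl_bracket x h) - gl_scale scale b (gl_bracket x g)"
proof -
  note [simp] = P.linear_add[OF linear_N[OF assms(1)]] P.linear_scale[OF linear_N[OF assms(1)]]
    P.linear_add[OF linear_N[OF assms(2)]] P.linear_scale[OF linear_N[OF assms(2)]]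
    N_comp_N[OF assms] N_comp_N[OF assms(2,1)]
  show ?thesis
    by (simp add: gl_bracket_def gl_scale_def fun_eq_iff scale_right_diff_distrib
        scale_right_distrib scale_left_commute)
qed

lemma x_in_K: "x \<in> K" and y_in_K: "y \<in> K"
  by (auto simp: K_def G.generated_subalgebra_def intro: hull_inc)

lemma ad_in_K: "ad k \<in> K"
  by (induct k) (auto simp: y_in_K K.bracket_closed x_in_K simp flip: bracket_x_ad)

text \<open>By \<open>bracket_K\<close> the span is closed under brackets, and it contains
  \<open>y = ad 0\<close>, so minimality of the hull gives one inclusion. The other holds as each
  \<open>ad k\<close> is an iterated bracket.\<close>

lemma K_eq_span: "K = G.span (insert x (ad ` UNIV))" (is "_ = ?H")
proof
  have dec: "\<exists>a. \<exists>g\<in>N 0. f = gl_scale scale a x + g" if "f \<in> ?H" for f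
    using that unfolding G.span_breakdown_eq N_def
    by (metis add.commute atLeast_0 diff_add_cancel)
  have "gl_bracket f g \<in> ?H" if f: "f \<in> ?H" and g: "g \<in> ?H" for f g
  proof -
    have "N (Suc 0) \<subseteq> ?H"
      unfolding N_def by (intro G.span_mono) auto
    moreover obtain a g' b h' where "g' \<in> N 0" "h' \<in> N 0"
      "f = gl_scale scale a x + g'" "g = gl_scale scale b x + h'"
      using dec[OF f] dec[OF g] by blast
    ultimately show ?thesis
      using bracket_x_N[of g' 0] bracket_x_N[of h' 0]
      by (simp add: bracket_K subset_iff G.span_diff G.span_scale)
  qed
  moreover have "?H \<subseteq> gl scale"
    by (intro G.span_minimal) (auto simp: G.subspace_carrier)
  moreover have "{x, y} \<subseteq> ?H"
    using rangeI[of ad 0] by (auto intro: G.span_base)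
  ultimately show "K \<subseteq> ?H"
    unfolding K_def G.generated_subalgebra_def
    by (intro hull_minimal) (auto simp: G.subalgebra_def)
  show "?H \<subseteq> K"
    by (intro G.span_minimal) (auto simp: x_in_K ad_in_K K.subspace_carrier)
qed

lemma K_cases:
  assumes "f \<in> K"
  obtains a g where "g \<in> N 0" "f = gl_scale scale a x + g"
proof -
  obtain a where "f - gl_scale scale a x \<in> N 0"
    using assms unfolding K_eq_span G.span_breakdown_eq N_def by auto
  then show thesis
    using that[of "f - gl_scale scale a x" a] by simp
qed

text \<open>Cutting off at \<open>p\<close> loses nothing by \<open>ad_eq_0\<close> and leaves
  \<open>p + 1\<close> elements.\<close>

definition K_basis :: "('v \<Rightarrow> 'v) set" where
  "K_basis = insert x (ad ` {..<p})"

lemma span_K_basis: "G.span K_basis = K"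
proof
  show "G.span K_basis \<subseteq> K"
    by (intro G.span_minimal) (auto simp: K_basis_def x_in_K ad_in_K K.subspace_carrier)
  have "ad k \<in> G.span K_basis" for k
    by (cases "k < p") (auto simp: K_basis_def ad_eq_0 G.span_zero intro: G.span_base)
  then show "K \<subseteq> G.span K_basis"
    unfolding K_eq_span
    by (intro G.span_minimal) (auto simp: K_basis_def intro: G.span_base)
qed

text \<open>Evaluation at \<open>hi 0\<close> turns a relation among the \<open>ad k\<close> into
  one among the \<open>lo k\<close>. The cardinality records that the \<open>ad k\<close> are
  distinct.\<close>

lemma independent_ad: "n \<le> p \<Longrightarrow> G.independent (ad ` {..<n}) \<and> card (ad ` {..<n}) = n"
proof (induct n)
  case (Suc n)
  have "ad n \<notin> G.span (ad ` {..<n})"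
  proof
    assume "ad n \<in> G.span (ad ` {..<n})"
    then have "ad n (hi 0) \<in> span (lo ` {..<n})"
      by (rule GV.linear_mem_if_mem_span[OF linear_apply])
        (use Suc in \<open>auto simp: ad_hi_0 intro: span_base\<close>)
    then show False
      using lo_notin_span[of n] Suc by (simp add: ad_hi_0)
  qed
  then show ?case
    using Suc by (auto simp: lessThan_Suc G.independent_insert intro: G.span_base)
qed (simp add: G.independent_empty)

text \<open>Elements of \<open>N 0\<close> kill \<open>lo 0\<close>, which \<open>x\<close> does
  not. Hence the coefficient of \<open>x\<close> in \<open>K_cases\<close> is unique.\<close>

lemma x_scale_in_N: "gl_scale scale a x \<in> N 0 \<Longrightarrow> a = 0"
  using N_on_span_lo[of "gl_scale scale a x" "lo 0"]
  by (simp add: span_base gl_scale_def)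

lemma x_notin_N: "x \<notin> N 0"
  using x_scale_in_N[of 1] by (auto simp: gl_scale_def)

lemma dim_K: "G.dim K = p + 1"
proof -
  have "x \<notin> G.span (ad ` {..<p})"
    using x_notin_N G.span_mono[of "ad ` {..<p}" "ad ` {0..}"] by (auto simp: N_def)
  moreover have "x \<notin> ad ` {..<p}"
    using calculation G.span_superset[of "ad ` {..<p}"] by auto
  ultimately have "G.independent K_basis" "card K_basis = p + 1"
    using independent_ad[of p] by (auto simp: K_basis_def G.independent_insert)
  then show ?thesis
    using G.dim_span_eq_card_independent span_K_basis by metis
qed

section \<open>The lower central series of \<open>K\<close>\<close>

lemma bracket_K_K: "f \<in> K \<Longrightarrow> g \<in> K \<Longrightarrow> gl_bracket f g \<in> N (Suc 0)"
  using bracket_x_N[of _ 0]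
  by (auto elim!: K_cases simp: bracket_K intro!: G.subspace_diff G.subspace_scale)

lemma bracket_K_N:
  assumes "f \<in> K" "g \<in> N m"
  shows "gl_bracket f g \<in> N (Suc m)"
proof -
  obtain a h where h: "h \<in> N 0" "f = gl_scale scale a x + h"
    using assms(1) by (rule K_cases)
  have "g \<in> N 0"
    using assms(2) N_antimono[of 0 m] by auto
  then have "gl_bracket f g = gl_scale scale a (gl_bracket x g)"
    using bracket_K[of h g a 0] h by simp
  then show ?thesis
    using bracket_x_N[OF assms(2)] by (simp add: G.subspace_scale)
qed

lemma ad_in_lower_central: "m \<le> k \<Longrightarrow> ad k \<in> K.lower_central m"
proof (induct m arbitrary: k)
  case (Suc m)
  then obtain k' where "k = Suc k'" "m \<le> k'"
    by (cases k) auto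
  then show ?case
    using K.bracket_in_bracket_span[OF x_in_K Suc.hyps[of k']] by simp
qed (simp add: ad_in_K)

text \<open>The first bracket removes the \<open>x\<close>-component, and each further one raises
  the filtration index by one. The formula starts at \<open>Suc n\<close> because
  \<open>K.lower_central 0\<close> is \<open>K\<close>, which contains \<open>x\<close> and so
  differs from \<open>N 0\<close>.\<close>

lemma lower_central_K: "K.lower_central (Suc n) = N (Suc n)"
proof
  show "K.lower_central (Suc n) \<subseteq> N (Suc n)"
  proof (induct n)
    case 0
    show ?case
      unfolding K.lower_central.simps by (intro K.bracket_span_minimal bracket_K_K) auto
  next
    case (Suc n)
    then show ?case
      unfolding K.lower_central.simps(2)[of "Suc n"]
      by (intro K.bracket_span_minimal bracket_K_N) (auto simp del: K.lower_central.simps)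
  qed
  show "N (Suc n) \<subseteq> K.lower_central (Suc n)"
    unfolding N_def
  proof (rule G.span_minimal)
    show "ad ` {Suc n..} \<subseteq> K.lower_central (Suc n)"
      using ad_in_lower_central by blast
  qed (simp add: K.bracket_span_def)
qed

lemma nilpotency_class_K: "K.has_nilpotency_class p"
proof -
  have "K.lower_central p = {0}"
    using lower_central_K[of "p - 1"] N_p two_le_p by simp
  moreover have "K.lower_central m \<noteq> {0}" if "m < p" for m
    using ad_in_lower_central[of m m] ad_neq_0[OF that] by auto
  ultimately show ?thesis
    by (simp add: K.has_nilpotency_class_def)
qed

lemma nilpotent_K: "K.nilpotent"
  using nilpotency_class_K by (auto simp: K.nilpotent_def K.has_nilpotency_class_def)

section \<open>The semidirect sum: failure of nilpotency and derived length\<close>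

lemma semidirect_bracket_linear:
  assumes "Vector_Spaces.linear scale scale f" "Vector_Spaces.linear scale scale g"
  shows "semidirect_bracket (f, 0) (g, u) = (gl_bracket f g, f u)"
  using P.linear_0[OF assms(2)] by (simp add: semidirect_bracket_def)

lemma linear_zero_fun: "Vector_Spaces.linear scale scale 0"
  using K_in_gl G.subspace_0[OF K.subspace_carrier] by (auto simp: gl_def)

lemma semidirect_bracket_vector:
  assumes "Vector_Spaces.linear scale scale f"
  shows "semidirect_bracket (f, 0) (0, u) = (0, f u)"
proof -
  have "gl_bracket f 0 = 0"
    by (simp add: gl_bracket_def fun_eq_iff P.linear_0[OF assms])
  then show ?thesis
    using semidirect_bracket_linear[OF assms linear_zero_fun] by metis
qed

text \<open>Since \<open>x\<close> is surjective, brackets with \<open>(x, 0)\<close> reproduce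
  every \<open>(0, u)\<close>, so each term of the series contains the whole abelian ideal.\<close>

lemma not_nilpotent_L: "\<not> L.nilpotent"
proof -
  have "(0, u) \<in> L.lower_central n" for n u
  proof (induct n arbitrary: u)
    case 0
    show ?case
      unfolding L.lower_central.simps(1) unfolding semidirect_def
      using G.subspace_0[OF K.subspace_carrier] by blast
  next
    case (Suc n)
    \<comment> \<open>By \<open>x ^^ p = id\<close> this is the preimage of \<open>u\<close> under
      \<open>x\<close>.\<close>
    let ?u = "(x ^^ (p - 1)) u"
    have "x ?u = (x ^^ Suc (p - 1)) u"
      by simp
    also have "Suc (p - 1) = p"
      using two_le_p by simp
    finally have "x ?u = u"
      by (simp add: x_funpow_p)
    moreover have "(x, 0) \<in> semidirect K"
      by (simp add: semidirect_def x_in_K)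
    note L.bracket_in_bracket_span[OF this Suc[of ?u]]
    ultimately show ?case
      unfolding semidirect_bracket_vector[OF linear_x] L.lower_central.simps by (simp only:)
  qed
  then have "(0, lo 0) \<in> L.lower_central n" for n .
  then show ?thesis
    using lo_neq_0[of 0] unfolding L.nilpotent_def zero_prod_def by blast
qed

text \<open>The series drops into \<open>N 1 \<times> UNIV\<close>, then into
  \<open>{0} \<times> ?U\<close>, then to zero. It does not end earlier: \<open>(ad 1, 0)\<close>
  and \<open>(0, hi 0)\<close> lie in the first derived term and have bracket
  \<open>(0, lo 1)\<close>.\<close>

lemma derived_length_L: "L.has_derived_length 3"
proof -
  let ?U = "span (range lo)"
  let ?D = "L.derived_series"
  have D_Suc: "?D (Suc n) \<subseteq> T"
    if "\<And>a b. a \<in> ?D n \<Longrightarrow> b \<in> ?D n \<Longrightarrow> semidirect_bracket a b \<in> T" "L.subspace T" for n T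
    unfolding L.derived_series.simps using that by (rule L.bracket_span_minimal)
  have subspace: "L.subspace (A \<times> B)" if "G.subspace A" "subspace B" for A B
    using that by (auto simp: L.subspace_def G.subspace_def subspace_def semidirect_scale_def
        zero_prod_def)
  have D1: "?D (Suc 0) \<subseteq> N (Suc 0) \<times> UNIV"
  proof (rule D_Suc)
    fix a b assume "a \<in> ?D 0" "b \<in> ?D 0"
    then have "fst a \<in> K" "fst b \<in> K"
      unfolding L.derived_series.simps by (simp_all add: semidirect_def mem_Times_iff)
    then show "semidirect_bracket a b \<in> N (Suc 0) \<times> UNIV"
      by (simp add: semidirect_bracket_def bracket_K_K)
  qed (simp add: subspace)
  have D2: "?D (Suc (Suc 0)) \<subseteq> {0} \<times> ?U"
  proof (rule D_Suc)
    fix a b assume "a \<in> ?D (Suc 0)" "b \<in> ?D (Suc 0)"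
    then have "fst a \<in> N (Suc 0)" "fst b \<in> N (Suc 0)"
      using D1[THEN subsetD] by (simp_all only: mem_Times_iff)
    then have "fst a \<in> N 0" "fst b \<in> N 0"
      using N_antimono[of 0 "Suc 0"] by auto
    then show "semidirect_bracket a b \<in> {0} \<times> ?U"
      by (simp add: semidirect_bracket_def gl_bracket_def fun_eq_iff N_comp_N N_in_span_lo
          span_diff)
  qed (auto intro: subspace G.subspace_single_0)
  have D3: "?D (Suc (Suc (Suc 0))) \<subseteq> {0}"
  proof (rule D_Suc)
    fix a b assume "a \<in> ?D (Suc (Suc 0))" "b \<in> ?D (Suc (Suc 0))"
    then have "fst a = 0" "fst b = 0"
      using D2[THEN subsetD] by (simp_all only: mem_Times_iff singleton_iff)
    then show "semidirect_bracket a b \<in> {0}"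
      by (simp add: semidirect_bracket_def gl_bracket_def fun_eq_iff prod_eq_iff)
  qed (rule L.subspace_single_0)
  have base: "semidirect_bracket a b \<in> ?D (Suc n)" if "a \<in> ?D n" "b \<in> ?D n" for a b n
    unfolding L.derived_series.simps using that by (rule L.bracket_in_bracket_span)
  have in0: "(f, u) \<in> ?D 0" if "f \<in> K" for f u
    unfolding L.derived_series.simps(1) unfolding semidirect_def using that by blast
  have zero_K: "0 \<in> K"
    by (rule G.subspace_0[OF K.subspace_carrier])
  have "semidirect_bracket (x, 0) (y, 0) \<in> ?D (Suc 0)"
    by (intro base in0 x_in_K y_in_K)
  then have ad1: "(ad 1, 0) \<in> ?D (Suc 0)"
    unfolding semidirect_bracket_linear[OF linear_x linear_y] using bracket_x_ad[of 0]
    by (simp del: L.derived_series.simps)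
  \<comment> \<open>With indices modulo \<open>p\<close>, \<open>hi (p - 1)\<close> is the preimage
    of \<open>hi 0\<close> under \<open>x\<close>.\<close>
  have "semidirect_bracket (x, 0) (0, hi (p - 1)) \<in> ?D (Suc 0)"
    by (intro base in0 x_in_K zero_K)
  moreover have "x (hi (p - 1)) = hi 0"
    using two_le_p by simp
  ultimately have "(0, hi 0) \<in> ?D (Suc 0)"
    unfolding semidirect_bracket_vector[OF linear_x] by metis
  with ad1 have "semidirect_bracket (ad 1, 0) (0, hi 0) \<in> ?D (Suc (Suc 0))"
    by (rule base)
  moreover have "ad 1 (hi 0) = lo 1"
    using two_le_p by (intro ad_hi_0) simp
  moreover have "Vector_Spaces.linear scale scale (ad 1)"
    using ad_in_N[of 0 1] linear_N by blast
  ultimately have "(0, lo 1) \<in> ?D (Suc (Suc 0))"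
    using semidirect_bracket_vector by metis
  moreover have "(0, lo 1) \<noteq> 0"
    by (simp add: zero_prod_def)
  ultimately have "?D (Suc (Suc 0)) \<noteq> {0}"
    by blast
  moreover have "?D (Suc 0) \<noteq> {0}"
    using ad1 ad_neq_0[of 1] two_le_p unfolding zero_prod_def by fastforce
  moreover have "?D 0 \<noteq> {0}"
    using in0[OF zero_K, of "lo 0"] lo_neq_0[of 0] unfolding zero_prod_def by blast
  ultimately have "?D m \<noteq> {0}" if "m < 3" for m
    using that unfolding numeral_3_eq_3 less_Suc_eq less_nat_zero_code
    by (elim disjE FalseE) (simp_all only: not_False_eq_True)
  moreover have "?D 3 = {0}"
  proof -
    have "0 \<in> ?D (Suc (Suc (Suc 0)))"
      unfolding L.derived_series.simps(2)[of "Suc (Suc 0)"] L.bracket_span_def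
      by (rule L.span_zero)
    then show ?thesis
      using D3 unfolding numeral_3_eq_3 by blast
  qed
  ultimately show ?thesis
    unfolding L.has_derived_length_def by blast
qed

section \<open>The derivation\<close>

lemma of_nat_mod_p: "of_nat (j mod p) = (of_nat j :: 'a)"
proof -
  have "(of_nat j :: 'a) = of_nat (j div p * p + j mod p)"
    by simp
  also have "\<dots> = of_nat (j mod p)"
    by (simp only: of_nat_add of_nat_mult of_nat_p mult_zero_right add_0)
  finally show ?thesis by simp
qed

text \<open>Negatives stay in \<open>range of_nat\<close>, so
  \<open>\<beta> \<notin> range of_nat\<close> will exclude
  \<open>\<beta> + of_nat k = 0\<close>.\<close>

lemma of_nat_neg: "- of_nat j = (of_nat ((p - 1) * j) :: 'a)"
proof -
  have "j + (p - 1) * j = p * j"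
    using two_le_p by (simp add: algebra_simps)
  then have "of_nat j + of_nat ((p - 1) * j) = (of_nat (p * j) :: 'a)"
    by (simp only: flip: of_nat_add)
  also have "\<dots> = 0"
    by simp
  finally show ?thesis
    by (rule minus_unique)
qed

lemma linear_coordinate_exists:
  "\<exists>E. Vector_Spaces.linear scale scale E \<and>
    (\<forall>j. E (lo j) = scale (\<beta> + of_nat j) (lo j) - scale s (lo (Suc j))) \<and>
    (\<forall>j. E (hi j) = scale (of_nat j) (hi j) - scale s (hi (Suc j)))"
proof -
  obtain E where E: "Vector_Spaces.linear scale scale E"
    "\<And>j. j < p \<Longrightarrow> E (lo j) = scale (\<beta> + of_nat j) (lo j) - scale s (lo (Suc j))"
    "\<And>j. j < p \<Longrightarrow> E (hi j) = scale (of_nat j) (hi j) - scale s (hi (Suc j))"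
    using linear_exists[of "\<lambda>j. scale (\<beta> + of_nat j) (lo j) - scale s (lo (Suc j))"
        "\<lambda>j. scale (of_nat j) (hi j) - scale s (hi (Suc j))"] by blast
  \<comment> \<open>Both sides of the formulas have period \<open>p\<close> in \<open>j\<close>, so
    they pass from representatives below \<open>p\<close> to all \<open>j\<close>.\<close>
  have "lo (Suc (j mod p)) = lo (Suc j)" "hi (Suc (j mod p)) = hi (Suc j)" for j
    by (metis x_lo lo_mod_p, metis x_hi hi_mod_p)
  then show ?thesis
    using E(1) E(2)[of "_ mod p"] E(3)[of "_ mod p"]
    by (intro exI[of _ E]) (simp add: of_nat_mod_p)
qed

text \<open>The condition on \<open>\<beta>\<close> makes every \<open>\<beta> + of_nat k\<close>
  nonzero, hence \<open>gl_bracket E\<close> invertible on \<open>K\<close>; the conditions on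
  \<open>s\<close> make \<open>E\<close> invertible on the two blocks.\<close>

context
  fixes \<beta> s :: 'a and E :: "'v \<Rightarrow> 'v"
  assumes linear_E: "Vector_Spaces.linear scale scale E"
    and E_lo: "\<And>j. E (lo j) = scale (\<beta> + of_nat j) (lo j) - scale s (lo (Suc j))"
    and E_hi: "\<And>j. E (hi j) = scale (of_nat j) (hi j) - scale s (hi (Suc j))"
    and \<beta>: "\<beta> \<notin> range of_nat"
    and s: "s \<noteq> 0" "s ^ p \<noteq> (\<Prod>j<p. \<beta> + of_nat j)"
begin

lemmas E_linear [simp] =
  P.linear_add[OF linear_E] P.linear_diff[OF linear_E] P.linear_scale[OF linear_E]
  P.linear_0[OF linear_E]

section \<open>The action of \<open>E\<close> on \<open>K\<close> and on the two blocks\<close>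

lemma E_in_gl: "E \<in> gl scale"
  by (simp add: gl_def linear_E)

text \<open>Each application of \<open>x\<close> raises the diagonal weight by one, also at the end
  of a cycle since \<open>of_nat p = 0\<close>; the part \<open>- s x\<close> commutes with
  \<open>x\<close>.\<close>

lemma bracket_E_x: "gl_bracket E x = x"
proof (rule linear_eqI)
  show "Vector_Spaces.linear scale scale (gl_bracket E x)"
    using G.bracket_closed[OF E_in_gl x_in_gl] by (simp add: gl_def)
qed (auto simp: linear_x gl_bracket_apply E_lo E_hi scale_left_distrib)

text \<open>The diagonal part scales \<open>y\<close> by \<open>\<beta>\<close>, and each bracket
  with \<open>x\<close> adds one by \<open>bracket_E_x\<close>; the part \<open>- s x\<close> gives
  the second term. The induction step is the Jacobi identity, checked on vectors.\<close>

lemma bracket_E_ad: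
  "gl_bracket E (ad k) = gl_scale scale (\<beta> + of_nat k) (ad k) - gl_scale scale s (ad (Suc k))"
proof (induct k)
  case 0
  have "gl_bracket E y = gl_scale scale \<beta> y - gl_scale scale s (gl_bracket x y)"
  proof (rule linear_eqI)
    show "Vector_Spaces.linear scale scale (gl_bracket E y)"
      using G.bracket_closed[OF E_in_gl y_in_gl] by (simp add: gl_def)
    have "gl_scale scale \<beta> y - gl_scale scale s (gl_bracket x y) \<in> gl scale"
      by (intro G.subspace_diff G.subspace_scale G.bracket_closed G.subspace_carrier) auto
    then show "Vector_Spaces.linear scale scale
        (gl_scale scale \<beta> y - gl_scale scale s (gl_bracket x y))"
      by (simp add: gl_def)
    show "gl_bracket E y (lo j) =
        (gl_scale scale \<beta> y - gl_scale scale s (gl_bracket x y)) (lo j)" for j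
      by (simp add: gl_bracket_apply gl_scale_def E_lo)
    show "gl_bracket E y (hi j) =
        (gl_scale scale \<beta> y - gl_scale scale s (gl_bracket x y)) (hi j)" for j
      \<comment> \<open>\<open>y (hi j)\<close> is nonzero only if \<open>p\<close> divides
        \<open>j\<close>, and then \<open>of_nat j\<close> is zero in the field.\<close>
      using of_nat_mod_p[of j]
      by (auto simp: gl_bracket_apply gl_scale_def E_lo E_hi scale_right_diff_distrib)
  qed
  then show ?case
    using bracket_x_ad[of 0] by simp
next
  case (Suc k)
  have lin: "Vector_Spaces.linear scale scale (ad k)"
    using ad_in_gl by (simp add: gl_def)
  have Ex: "E (x u) = x (E u) + x u" for u
    using fun_cong[OF bracket_E_x, of u] by (simp add: gl_bracket_apply algebra_simps)
  have Ea: "E (ad k u) = ad k (E u) + scale (\<beta> + of_nat k) (ad k u) - scale s (ad (Suc k) u)" for u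
    using fun_cong[OF Suc, of u] by (simp add: gl_bracket_apply gl_scale_def algebra_simps)
  show ?case
    by (rule ext)
      (simp add: gl_bracket_apply gl_scale_def ad_Suc_apply Ex Ea P.linear_add[OF lin]
        P.linear_diff[OF lin] scale_left_distrib scale_right_diff_distrib algebra_simps)
qed

text \<open>\<open>cycle_mem_subspace\<close> puts both cycles into the range, and surjectivity
  suffices in finite dimension.\<close>

lemma bij_E: "bij E"
proof -
  interpret fd: finite_dimensional_vector_space scale "v ` {1..2*p}"
    by unfold_locales (auto simp: independent_v[simplified] span_v[simplified])
  have R: "subspace (range E)"
    by (intro P.linear_subspace_image linear_E subspace_UNIV)
  have "lo j \<in> range E" for j
  proof (rule cycle_mem_subspace[OF R _ lo_p s])
    show "scale (\<beta> + of_nat j) (lo j) - scale s (lo (Suc j)) \<in> range E" for j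
      using E_lo by (metis rangeI)
  qed
  moreover have "hi j \<in> range E" for j
  proof (rule cycle_mem_subspace[OF R _ hi_p s(1)])
    show "scale (of_nat j) (hi j) - scale s (hi (Suc j)) \<in> range E" for j
      using E_hi by (metis rangeI)
    \<comment> \<open>The second block has a zero diagonal entry, so its condition reduces to
      \<open>s ^ p \<noteq> 0\<close>.\<close>
    have "(\<Prod>j<p. of_nat j) = (0::'a)"
      using two_le_p by (intro prod_zero bexI[of _ 0]) auto
    then show "s ^ p \<noteq> (\<Prod>j<p. of_nat j)"
      using s(1) by (metis power_not_zero)
  qed
  ultimately have "span (lo ` {..<p} \<union> hi ` {..<p}) \<subseteq> range E"
    by (intro span_minimal R) auto
  then have "surj E"
    by (simp add: span_lo_hi top.extremum_unique)
  then show ?thesis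
    using fd.linear_surj_imp_inj[OF linear_E] by (simp add: bij_def)
qed

lemma \<beta>_add_neq_0: "\<beta> + of_nat k \<noteq> 0"
  using \<beta> of_nat_neg[of k] by (metis add_eq_0_iff2 rangeI)

text \<open>By \<open>bracket_E_ad\<close> the action on the filtration is triangular, with one
  scalar per layer.\<close>

lemma bracket_E_N: "g \<in> N m \<Longrightarrow> gl_bracket E g - gl_scale scale (\<beta> + of_nat m) g \<in> N (Suc m)"
  unfolding N_def
proof (erule GG.linear_mem_if_mem_span[rotated])
  show "Vector_Spaces.linear (gl_scale scale) (gl_scale scale)
      (\<lambda>g. gl_bracket E g - gl_scale scale (\<beta> + of_nat m) g)"
    by (intro GG.linear_compose_sub linear_bracket linear_E G.linear_scale_self)
  fix b assume "b \<in> ad ` {m..}"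
  then obtain k where "m \<le> k" "b = ad k"
    by auto
  have base: "ad j \<in> G.span (ad ` {Suc m..})" if "Suc m \<le> j" for j
    using that by (auto intro: G.span_base)
  show "gl_bracket E b - gl_scale scale (\<beta> + of_nat m) b \<in> G.span (ad ` {Suc m..})"
  proof (cases "k = m")
    case True
    have "gl_bracket E b - gl_scale scale (\<beta> + of_nat m) b = - gl_scale scale s (ad (Suc m))"
      using True \<open>b = ad k\<close> by (simp add: bracket_E_ad)
    then show ?thesis
      using base by (simp only: G.span_neg G.span_scale)
  next
    case False
    then show ?thesis
      unfolding \<open>b = ad k\<close> bracket_E_ad using \<open>m \<le> k\<close>
      by (intro G.span_diff G.span_scale base) auto
  qed
qed simp

lemma bracket_E_K:
  assumes "f \<in> K"
  shows "gl_bracket E f \<in> K"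
proof (rule GG.linear_mem_if_mem_span[OF linear_bracket[OF linear_E] _ _ K.subspace_carrier])
  show "f \<in> G.span K_basis"
    using assms by (simp add: span_K_basis)
  fix b assume "b \<in> K_basis"
  moreover have "gl_bracket E (ad k) \<in> K" for k
    unfolding bracket_E_ad
    by (intro G.subspace_diff G.subspace_scale K.subspace_carrier ad_in_K)
  ultimately show "gl_bracket E b \<in> K"
    by (auto simp: K_basis_def bracket_E_x x_in_K simp del: ad_0)
qed

text \<open>The scalar of each layer is nonzero, so an element killed by the bracket sinks from
  \<open>N m\<close> to \<open>N (Suc m)\<close> until it reaches \<open>N p = {0}\<close>.\<close>

lemma bracket_E_inj_N:
  assumes "g \<in> N 0" "gl_bracket E g = 0"
  shows "g = 0"
proof -
  have "g \<in> N m" for m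
  proof (induct m)
    case (Suc m)
    have "- gl_scale scale (\<beta> + of_nat m) g \<in> N (Suc m)"
      using bracket_E_N[OF Suc] assms(2) by simp
    then have "gl_scale scale (\<beta> + of_nat m) g \<in> N (Suc m)"
      using G.subspace_neg[OF subspace_N, of "- gl_scale scale (\<beta> + of_nat m) g"] by simp
    then have "gl_scale scale (inverse (\<beta> + of_nat m)) (gl_scale scale (\<beta> + of_nat m) g)
        \<in> N (Suc m)"
      by (rule G.subspace_scale[OF subspace_N])
    then show ?case
      using \<beta>_add_neq_0[of m] by simp
  qed (rule assms(1))
  then have "g \<in> N p" .
  then show ?thesis
    by (simp add: N_p)
qed

lemma bij_bracket_E: "bij_betw (gl_bracket E) K K"
proof -
  note lin = linear_bracket[OF linear_E]
  have "f = 0" if "f \<in> K" "gl_bracket E f = 0" for f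
  proof -
    obtain a g where g: "g \<in> N 0" "f = gl_scale scale a x + g"
      using \<open>f \<in> K\<close> by (rule K_cases)
    then have eq: "gl_scale scale a x + gl_bracket E g = 0"
      using that(2) by (simp add: GG.linear_add[OF lin] GG.linear_scale[OF lin] bracket_E_x)
    have "gl_bracket E g - gl_scale scale (\<beta> + of_nat 0) g \<in> N 0"
      using bracket_E_N[OF g(1)] N_antimono[of 0 "Suc 0"] by auto
    then have "gl_bracket E g \<in> N 0"
      using G.subspace_add[OF subspace_N _ G.subspace_scale[OF subspace_N g(1)]]
      by (metis diff_add_cancel)
    then have "a = 0"
      using eq G.subspace_neg[OF subspace_N, of "gl_bracket E g" 0]
      by (metis eq_neg_iff_add_eq_0 x_scale_in_N)
    then show "f = 0"
      using g eq bracket_E_inj_N[OF g(1)] by simp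
  qed
  then have "inj_on (gl_bracket E) K"
    using GG.linear_inj_on_iff_eq_0[OF lin K.subspace_carrier] by blast
  moreover have "gl_bracket E ` K = K"
  proof
    show "gl_bracket E ` K \<subseteq> K"
      using bracket_E_K by auto
    have R: "G.subspace (gl_bracket E ` K)"
      by (intro GG.linear_subspace_image lin K.subspace_carrier)
    \<comment> \<open>Downward induction from \<open>ad p = 0\<close>: \<open>gl_bracket E\<close>
      sends \<open>ad k\<close> to a nonzero multiple of itself plus a multiple of
      \<open>ad (Suc k)\<close>.\<close>
    have "ad k \<in> gl_bracket E ` K" if "k \<le> p" for k
      using that
    proof (induct k rule: inc_induct)
      case base
      show ?case
        unfolding ad_p by (rule G.subspace_0[OF R])
    next
      case (step k)
      have "gl_bracket E (ad k) + gl_scale scale s (ad (Suc k)) \<in> gl_bracket E ` K"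
        using step ad_in_K by (intro G.subspace_add[OF R] G.subspace_scale[OF R]) auto
      then have "gl_scale scale (\<beta> + of_nat k) (ad k) \<in> gl_bracket E ` K"
        by (simp add: bracket_E_ad)
      then have "gl_scale scale (inverse (\<beta> + of_nat k)) (gl_scale scale (\<beta> + of_nat k) (ad k))
          \<in> gl_bracket E ` K"
        by (rule G.subspace_scale[OF R])
      then show ?case
        using \<beta>_add_neq_0[of k] by simp
    qed
    moreover have "x \<in> gl_bracket E ` K"
      using bracket_E_x x_in_K by (metis imageI)
    ultimately have "G.span K_basis \<subseteq> gl_bracket E ` K"
      by (intro G.span_minimal R) (auto simp: K_basis_def)
    then show "K \<subseteq> gl_bracket E ` K"
      by (simp add: span_K_basis)
  qed
  ultimately show ?thesis
    by (simp add: bij_betw_def)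
qed

text \<open>The map is the restriction of the bracket with \<open>(E, 0)\<close> in the semidirect
  sum of all of \<open>gl scale\<close> with the vector space.\<close>

lemma derivation_E: "L.derivation (map_prod (gl_bracket E) E)"
proof -
  have lin: "Vector_Spaces.linear scale scale f" if "f \<in> K" for f
    using that K_in_gl by (auto simp: gl_def)
  note [simp] = P.linear_add[OF lin] P.linear_diff[OF lin]
  show ?thesis
    unfolding L.derivation_def
    by (auto simp: semidirect_def semidirect_scale_def semidirect_bracket_def bracket_E_K
        GG.linear_add[OF linear_bracket[OF linear_E]]
        GG.linear_scale[OF linear_bracket[OF linear_E]])
      (auto simp: gl_bracket_def fun_eq_iff)
qed

lemma nonsingular_E: "L.nonsingular (map_prod (gl_bracket E) E)"
  unfolding L.nonsingular_def unfolding semidirect_def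
  by (intro bij_betw_map_prod bij_bracket_E) (simp add: bij_E)

text \<open>Relative to \<open>K_basis\<close> and to the two cycles all coefficients lie in
  \<open>S\<close>, so \<open>linear_finite_order\<close> handles each component.\<close>

lemma finite_order_E:
  assumes S: "subfield S" "finite S" "\<beta> \<in> S" "s \<in> S"
  shows "L.finite_order (map_prod (gl_bracket E) E)"
proof -
  note closed = subfield_closed[OF \<open>subfield S\<close>]
  have "\<exists>m\<ge>1. \<forall>f\<in>G.span K_basis. (gl_bracket E ^^ m) f = f"
  proof (rule G.linear_finite_order[OF linear_bracket[OF linear_E] _ S(2,1)])
    show fin: "finite K_basis"
      by (simp add: K_basis_def)
    show "inj_on (gl_bracket E) (G.span K_basis)"
      using bij_bracket_E by (simp add: span_K_basis bij_betw_def)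
    fix b assume b: "b \<in> K_basis"
    note two = G.two_term_combination[OF fin S(1) b]
    consider "b = x" | k where "k < p" "b = ad k"
      using b by (auto simp: K_basis_def)
    then show "\<exists>c\<in>K_basis \<rightarrow> S. gl_bracket E b = (\<Sum>b\<in>K_basis. gl_scale scale (c b) b)"
    proof cases
      case 1
      then show ?thesis
        using two[of 0 1 0] closed by (simp add: bracket_E_x)
    next
      case 2
      have "ad (Suc k) \<in> K_basis \<or> ad (Suc k) = 0"
        using 2 ad_eq_0[of "Suc k"] by (cases "Suc k < p") (auto simp: K_basis_def)
      then have "\<exists>c\<in>K_basis \<rightarrow> S. gl_scale scale (\<beta> + of_nat k) b + gl_scale scale (- s) (ad (Suc k)) =
          (\<Sum>b\<in>K_basis. gl_scale scale (c b) b)"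
        by (rule two) (simp_all add: closed S)
      then show ?thesis
        using 2 by (simp add: bracket_E_ad)
    qed
  qed
  then obtain m where m: "m \<ge> 1" "\<And>f. f \<in> K \<Longrightarrow> (gl_bracket E ^^ m) f = f"
    by (auto simp: span_K_basis)
  let ?B = "lo ` {..<p} \<union> hi ` {..<p}"
  have B: "lo j \<in> ?B" "hi j \<in> ?B" for j
    by (metis UnI1 imageI lessThan_iff lo_mod_p mod_p_less,
        metis UnI2 imageI lessThan_iff hi_mod_p mod_p_less)
  have "\<exists>n\<ge>1. \<forall>u\<in>span ?B. (E ^^ n) u = u"
  proof (rule linear_finite_order[OF linear_E _ S(2,1)])
    show fin: "finite ?B"
      by simp
    show "inj_on E (span ?B)"
      using bij_E by (simp add: span_lo_hi bij_def)
    fix b assume "b \<in> ?B"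
    then consider j where "b = lo j" | j where "b = hi j"
      by auto
    then show "\<exists>c\<in>?B \<rightarrow> S. E b = (\<Sum>b\<in>?B. scale (c b) b)"
    proof cases
      case 1
      have "\<exists>c\<in>?B \<rightarrow> S. scale (\<beta> + of_nat j) (lo j) + scale (- s) (lo (Suc j)) =
          (\<Sum>b\<in>?B. scale (c b) b)"
        by (rule two_term_combination[OF fin S(1)]) (use B in \<open>auto simp: closed S\<close>)
      then show ?thesis
        using 1 by (simp add: E_lo)
    next
      case 2
      have "\<exists>c\<in>?B \<rightarrow> S. scale (of_nat j) (hi j) + scale (- s) (hi (Suc j)) =
          (\<Sum>b\<in>?B. scale (c b) b)"
        by (rule two_term_combination[OF fin S(1)]) (use B in \<open>auto simp: closed S\<close>)
      then show ?thesis
        using 2 by (simp add: E_hi)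
    qed
  qed
  then obtain n where n: "n \<ge> 1" "\<And>u. (E ^^ n) u = u"
    by (auto simp: span_lo_hi)
  \<comment> \<open>The product of the two exponents serves both components at once.\<close>
  have "(gl_bracket E ^^ (m * n)) f = f" if "f \<in> K" for f
    using m(2)[OF that] by (rule funpow_fixed_mult)
  moreover have "(E ^^ (m * n)) u = u" for u
    using funpow_fixed_mult[OF n(2), of m] by (simp add: mult.commute)
  ultimately show ?thesis
    unfolding L.finite_order_def funpow_map_prod using m(1) n(1)
    by (intro exI[of _ "m * n"]) (auto simp: semidirect_def)
qed

end

text \<open>\<open>S\<close> has more elements than the prime field, which leaves room for
  \<open>\<beta>\<close>; then \<open>s\<close> can be taken as \<open>1\<close> or
  \<open>\<beta>\<close>.\<close>

lemma parameters_exist: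
  fixes S :: "'a set"
  assumes "subfield S" "infinite S \<or> p ^ 2 \<le> card S"
  shows "\<exists>\<beta>\<in>S. \<exists>s\<in>S. \<beta> \<notin> range of_nat \<and> s \<noteq> 0 \<and> s ^ p \<noteq> (\<Prod>j<p. \<beta> + of_nat j)"
proof -
  note S = subfield_closed[OF \<open>subfield S\<close>]
  have range: "range of_nat = (of_nat ` {..<p} :: 'a set)"
    using of_nat_mod_p mod_p_less by (auto simp: image_iff) (metis lessThan_iff mod_p_less)
  then have "finite (range of_nat :: 'a set)" "card (range of_nat :: 'a set) \<le> p"
    using card_image_le[of "{..<p}" "of_nat :: nat \<Rightarrow> 'a"] by auto
  moreover have "p < p ^ 2"
    using two_le_p by (simp add: power2_eq_square)
  ultimately have "\<not> S \<subseteq> range of_nat"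
    using assms(2) card_mono[of "range of_nat" S] finite_subset[of S "range of_nat"] by fastforce
  then obtain \<beta> where \<beta>: "\<beta> \<in> S" "\<beta> \<notin> range of_nat"
    by blast
  \<comment> \<open>This is injectivity of the Frobenius map:
    \<open>(\<beta> - 1) ^ p = \<beta> ^ p - 1\<close>.\<close>
  have "\<beta> ^ p \<noteq> 1"
  proof
    assume "\<beta> ^ p = 1"
    moreover have "((\<beta> - 1) + 1) ^ p = (\<beta> - 1) ^ p + 1"
      using freshmans_dream[where x = "\<beta> - 1" and y = 1] prime_p char_p by simp
    ultimately have "\<beta> = 1"
      by simp
    then show False
      using \<beta>(2) by (metis of_nat_1 rangeI)
  qed
  moreover have "\<beta> \<noteq> 0"
    using \<beta>(2) by (metis of_nat_0 rangeI)
  \<comment> \<open>\<open>1 ^ p\<close> and \<open>\<beta> ^ p\<close> differ, so at least one of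
    \<open>s = 1\<close> and \<open>s = \<beta>\<close> avoids the product.\<close>
  ultimately show ?thesis
    using \<beta> S(2) by (metis power_one zero_neq_one)
qed

end

theorem proposition3p1:
  fixes scale :: "'a::field \<Rightarrow> 'v::ab_group_add \<Rightarrow> 'v"
    and p :: nat
    and v :: "nat \<Rightarrow> 'v"
    and x y :: "'v \<Rightarrow> 'v"
    and K :: "('v \<Rightarrow> 'v) set"
    and L :: "(('v \<Rightarrow> 'v) \<times> 'v) set"
  assumes "prime p" and "CHAR('a) = p"
    and "vector_space scale"
    and "inj_on v {1..2*p}"
    and "\<not> module.dependent scale (v ` {1..2*p})"
    and "module.span scale (v ` {1..2*p}) = UNIV"
    and "Vector_Spaces.linear scale scale x"
    and "\<And>i. i \<in> {1..p-1} \<Longrightarrow> x (v i) = v (i + 1)"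
    and "x (v p) = v 1"
    and "\<And>i. i \<in> {1..p-1} \<Longrightarrow> x (v (p + i)) = v (p + i + 1)"
    and "x (v (2*p)) = v (p + 1)"
    and "Vector_Spaces.linear scale scale y"
    and "y (v (p + 1)) = v 1"
    and "\<And>i. i \<in> {1..2*p} \<Longrightarrow> i \<noteq> p + 1 \<Longrightarrow> y (v i) = 0"
  defines "K \<equiv> lie_algebra.generated_subalgebra (gl_scale scale) (gl scale) gl_bracket {x, y}"
    and "L \<equiv> semidirect K"
  shows "(lie_algebra (gl_scale scale) K gl_bracket \<and>
          lie_algebra.nilpotent (gl_scale scale) K gl_bracket \<and>
          vector_space.dim (gl_scale scale) K = p + 1 \<and>
          lie_algebra.has_nilpotency_class (gl_scale scale) K gl_bracket p) \<and>
         (lie_algebra (semidirect_scale scale) L semidirect_bracket \<and>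
          \<not> lie_algebra.nilpotent (semidirect_scale scale) L semidirect_bracket \<and>
          lie_algebra.has_derived_length (semidirect_scale scale) L semidirect_bracket 3) \<and>
         (infinite (UNIV :: 'a set) \<or> p ^ 2 \<le> card (UNIV :: 'a set) \<longrightarrow>
          (\<exists>\<delta>. lie_algebra.derivation (semidirect_scale scale) L semidirect_bracket \<delta> \<and>
               lie_algebra.nonsingular L \<delta> \<and>
               (has_finite_subfield_of_size_ge TYPE('a) (p ^ 2) \<longrightarrow>
                lie_algebra.finite_order L \<delta>)))"
proof -
  interpret shift_module scale p v x y
    using assms unfolding shift_module_def shift_module_axioms_def by blast
  have K: "K = shift_module.K scale x y"
    by (simp add: assms(15) shift_module.K_def[OF shift_module_axioms])
  have part3: "\<exists>\<delta>. L.derivation \<delta> \<and> L.nonsingular \<delta> \<and>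
      (has_finite_subfield_of_size_ge TYPE('a) (p ^ 2) \<longrightarrow> L.finite_order \<delta>)"
    if large: "infinite (UNIV :: 'a set) \<or> p ^ 2 \<le> card (UNIV :: 'a set)"
  proof -
    \<comment> \<open>One derivation must serve both claims, so \<open>S\<close> is a large enough
      finite subfield whenever one exists and the whole field otherwise.\<close>
    obtain S :: "'a set" where S: "subfield S" "infinite S \<or> p ^ 2 \<le> card S"
      "has_finite_subfield_of_size_ge TYPE('a) (p ^ 2) \<Longrightarrow> finite S"
    proof (cases "has_finite_subfield_of_size_ge TYPE('a) (p ^ 2)")
      case True
      then show thesis
        using that unfolding has_finite_subfield_of_size_ge_def by blast
    next
      case False
      have "subfield (UNIV :: 'a set)"
        by (simp add: subfield_def)
      then show thesis
        using that[of UNIV] large False by blast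
    qed
    obtain \<beta> s where \<beta>s: "\<beta> \<in> S" "s \<in> S" "\<beta> \<notin> range of_nat" "s \<noteq> 0"
      "s ^ p \<noteq> (\<Prod>j<p. \<beta> + of_nat j)"
      using parameters_exist[OF S(1,2)] by blast
    obtain E where E: "Vector_Spaces.linear scale scale E"
      "\<And>j. E (lo j) = scale (\<beta> + of_nat j) (lo j) - scale s (lo (Suc j))"
      "\<And>j. E (hi j) = scale (of_nat j) (hi j) - scale s (hi (Suc j))"
      using linear_coordinate_exists[of \<beta> s] by blast
    show ?thesis
      using derivation_E[OF E \<beta>s(3-5)] nonsingular_E[OF E \<beta>s(3-5)]
        finite_order_E[OF E \<beta>s(3-5) S(1) S(3) \<beta>s(1,2)] by blast
  qed
  show ?thesis
    unfolding L_def K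
    using K.lie_algebra_axioms nilpotent_K dim_K nilpotency_class_K
      L.lie_algebra_axioms not_nilpotent_L derived_length_L part3
    by blast
qed

end
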